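(* For all non-negative integers $m,n$, the odd $q$-super Catalan number \[ C_{m,n}(q)=\frac{[2m+1]!\,[2n]!}{[m+n+1]!\,[m]!\,[n]!} \] is a polynomial in $q$ with non-negative integer coefficients.
   Context: For a non-negative integer $n$, $[n]=\frac{1-q^n}{1-q}=1+q+\cdots+q^{n-1}$, $[n]!=[1][2]\cdots[n]$, and $[0]!=1$. *)

theory Defs
  imports "HOL-Computational_Algebra.Computational_Algebra"
begin

text \<open>
  The indeterminate \<open>q\<close> is \<open>monom 1 1 :: int poly\<close>, and rational functions in \<open>q\<close> are the
  elements of the fraction field of \<open>int poly\<close>.
\<close>

definition q_int :: "nat \<Rightarrow> int poly" where
  "q_int n = (\<Sum>i<n. monom 1 i)"

lemma q_int_closed_form:
  "to_fract (q_int n) = to_fract (1 - monom 1 n) / to_fract (1 - monom 1 1)"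
proof -
  have "(1 - monom 1 1) * q_int n = 1 - monom 1 n"
  proof (induction n)
    case (Suc n)
    have "(1 - monom 1 1) * q_int (Suc n) = (1 - monom 1 1) * q_int n + (1 - monom 1 1) * monom 1 n"
      by (simp add: q_int_def distrib_left)
    also have "\<dots> = 1 - monom 1 (Suc n)"
      unfolding Suc.IH by (simp add: left_diff_distrib mult_monom)
    finally show ?case .
  qed (simp add: q_int_def)
  moreover have "coeff (1 - monom 1 1 :: int poly) 0 = 1"
    by simp
  then have "1 - monom 1 1 \<noteq> (0 :: int poly)"
    by (metis coeff_0 zero_neq_one)
  ultimately show ?thesis
    by (metis nonzero_mult_div_cancel_left to_fract_eq_0_iff to_fract_mult)
qed

definition q_fact :: "nat \<Rightarrow> int poly" where
  "q_fact n = (\<Prod>k=1..n. q_int k)"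

definition odd_q_super_catalan :: "nat \<Rightarrow> nat \<Rightarrow> int poly fract" where
  "odd_q_super_catalan m n =
     to_fract (q_fact (2 * m + 1) * q_fact (2 * n)) /
     to_fract (q_fact (m + n + 1) * q_fact m * q_fact n)"

lemma q_int_nonzero: "n > 0 \<Longrightarrow> q_int n \<noteq> 0"
proof
  assume "n > 0" and "q_int n = 0"
  have "coeff (q_int n) 0 = 1"
    using \<open>n > 0\<close> by (simp add: q_int_def coeff_sum)
  then show False
    using \<open>q_int n = 0\<close> by simp
qed

lemma odd_q_super_catalan_denominator_nonzero:
  "to_fract (q_fact (m + n + 1) * q_fact m * q_fact n) \<noteq> 0"
  by (simp add: q_fact_def q_int_nonzero)

end

theory Submission
  imports Defs
begin

text \<open>
  Let \<open>S(m,n) = [2m]![2n]!/([m]![n]![m+n]!)\<close>. Two applications of the \<open>q\<close>-Vandermonde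
  convolution turn the quotient \<open>[2N+2P]!/([N+P]![P]![2N+P]!)\<close> into a double sum of reciprocals of
  \<open>q\<close>-factorials. Multiplied by suitable factors, it expands \<open>S(n+p,n)\<close> in the
  \<open>S(a,n)\<close> with \<open>2a \<le> p\<close>, and, if \<open>n = m+1+p\<close>, it expands \<open>C(m,n)\<close> in the
  \<open>C(m,a)\<close> with \<open>2a \<le> p\<close>; the coefficients are powers of \<open>q\<close> times
  \<open>q\<close>-trinomial coefficients. If \<open>m = n+1+p\<close>, then splitting the factor
  \<open>[2m+1] = [m+n+1] + q^(m+n+1) [m-n]\<close> of the numerator writes \<open>C(m,n)\<close> as \<open>S(m,n)\<close> plus such a combination of the
  \<open>C(a,n)\<close> with \<open>2a \<le> p\<close>, and \<open>C(m,m) = S(m,m)\<close>. Positivity follows by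
  induction on \<open>m+n\<close>.
\<close>

section \<open>q-integers and q-factorials in the fraction field\<close>

definition Q :: "int poly fract" where
  "Q = to_fract (monom 1 1)"

definition qi :: "nat \<Rightarrow> int poly fract" where
  "qi n = to_fract (q_int n)"

definition qf :: "nat \<Rightarrow> int poly fract" where
  "qf n = to_fract (q_fact n)"

lemma qi_0 [simp]: "qi 0 = 0"
  by (simp add: qi_def q_int_def)

lemma Q_power: "Q ^ n = to_fract (monom 1 n)"
  by (induction n) (simp_all add: Q_def mult_monom flip: to_fract_mult)

lemma qi_Suc: "qi (Suc n) = qi n + Q ^ n"
  by (simp add: qi_def q_int_def Q_power)

text \<open>Cut the geometric sum after its first \<open>m\<close> terms. Both the q-Pascal rule and
  the splitting of the factor [2m+1] rest on this.\<close>

lemma qi_add: "qi (m + n) = qi m + Q ^ m * qi n"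
  by (induction n) (simp_all add: qi_Suc algebra_simps power_add)

lemma qf_0 [simp]: "qf 0 = 1"
  by (simp add: qf_def q_fact_def)

lemma qf_Suc: "qf (Suc n) = qf n * qi (Suc n)"
  by (simp add: qf_def qi_def q_fact_def)

lemma qf_nonzero [simp]: "qf n \<noteq> 0"
  by (simp add: qf_def q_fact_def q_int_nonzero)

lemma qi_Suc_nonzero [simp]: "qi (Suc n) \<noteq> 0"
  by (simp add: qi_def q_int_nonzero)

section \<open>q-binomial coefficients and the q-Vandermonde convolution\<close>

definition qbinom :: "nat \<Rightarrow> nat \<Rightarrow> int poly fract" where
  "qbinom n k = (if k \<le> n then qf n / (qf k * qf (n - k)) else 0)"

lemma qbinom_0 [simp]: "qbinom n 0 = 1"
  by (simp add: qbinom_def)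

lemma qbinom_eq_0 [simp]: "n < k \<Longrightarrow> qbinom n k = 0"
  by (simp add: qbinom_def)

lemma qbinom_add: "qbinom (k + l) k = qf (k + l) / (qf k * qf l)"
  by (simp add: qbinom_def)

text \<open>This q-Pascal rule comes from [n+1] = [n-k] + q^(n-k) [k+1]. Truncation in
  \<open>n - k\<close> does no harm: for \<open>k > n\<close> the factor \<open>qbinom n k\<close>
  is 0.\<close>

lemma qbinom_Suc_Suc: "qbinom (Suc n) (Suc k) = Q ^ (n - k) * qbinom n k + qbinom n (Suc k)"
proof (cases "k < n")
  case True
  then obtain r where n: "n = k + Suc r"
    by (metis less_iff_Suc_add add_Suc_right)
  have "qi (Suc (k + Suc r)) = qi (Suc r) + Q ^ Suc r * qi (Suc k)"
    by (metis add.commute add_Suc_right qi_add)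
  then show ?thesis
    by (simp add: n qbinom_def qf_Suc divide_simps) (simp add: algebra_simps)
next
  case False
  then show ?thesis
    by (cases "k = n") (auto simp: qbinom_def)
qed

text \<open>Pascal's rule in the upper index \<open>Suc b\<close> yields two sums of the same shape,
  one for \<open>(N, c)\<close> and one for \<open>(Suc N, c - 1)\<close>. The total
  \<open>N + c\<close> is the same in both, and Pascal's rule recombines their values. Hence the
  induction on \<open>b\<close> leaves \<open>N\<close> and \<open>c\<close> arbitrary.\<close>

lemma q_vandermonde:
  "(\<Sum>a\<le>c. Q ^ (a * (a + N)) * qbinom b a * qbinom (N + c) (c - a)) = qbinom (N + b + c) c"
proof (induction b arbitrary: N c)
  case 0
  have "(\<Sum>a\<le>c. Q ^ (a * (a + N)) * qbinom 0 a * qbinom (N + c) (c - a)) =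
      (\<Sum>a\<le>c. if a = 0 then qbinom (N + c) c else 0)"
    by (rule sum.cong) auto
  then show ?case
    by simp
next
  case (Suc b)
  show ?case
  proof (cases c)
    case (Suc d)
    \<comment> \<open>After the index shift, the exponent minus the constant
      \<open>N + b + 1\<close> is again of the form a(a+N'), now with N' = \<open>Suc N\<close>. For
      \<open>a > b\<close> both sides vanish.\<close>
    have shift: "Q ^ (Suc a * (Suc a + N)) * (Q ^ (b - a) * qbinom b a) =
        Q ^ (N + b + 1) * (Q ^ (a * (a + Suc N)) * qbinom b a)" for a
    proof (cases "a \<le> b")
      case True
      then have "Suc a * (Suc a + N) + (b - a) = N + b + 1 + a * (a + Suc N)"
        by (simp add: algebra_simps)
      then have "Q ^ (Suc a * (Suc a + N)) * Q ^ (b - a) = Q ^ (N + b + 1) * Q ^ (a * (a + Suc N))"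
        by (metis power_add)
      then show ?thesis
        by (simp only: mult.assoc [symmetric])
    qed simp
    have "(\<Sum>a\<le>c. Q ^ (a * (a + N)) * qbinom (Suc b) a * qbinom (N + c) (c - a)) =
        qbinom (N + c) c +
        (\<Sum>a\<le>d. Q ^ (Suc a * (Suc a + N)) * qbinom (Suc b) (Suc a) * qbinom (N + c) (d - a))"
      unfolding Suc by (subst sum.atMost_Suc_shift) simp
    also have "(\<Sum>a\<le>d. Q ^ (Suc a * (Suc a + N)) * qbinom (Suc b) (Suc a) * qbinom (N + c) (d - a)) =
        (\<Sum>a\<le>d. Q ^ (Suc a * (Suc a + N)) * (Q ^ (b - a) * qbinom b a) * qbinom (N + c) (d - a)) +
        (\<Sum>a\<le>d. Q ^ (Suc a * (Suc a + N)) * qbinom b (Suc a) * qbinom (N + c) (d - a))"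
      by (simp only: qbinom_Suc_Suc distrib_left distrib_right sum.distrib)
    also have "(\<Sum>a\<le>d. Q ^ (Suc a * (Suc a + N)) * (Q ^ (b - a) * qbinom b a) * qbinom (N + c) (d - a)) =
        Q ^ (N + b + 1) * (\<Sum>a\<le>d. Q ^ (a * (a + Suc N)) * qbinom b a * qbinom (Suc N + d) (d - a))"
      unfolding shift Suc by (simp add: sum_distrib_left mult.assoc)
    also have "\<dots> = Q ^ (N + b + 1) * qbinom (Suc N + b + d) d"
      by (simp only: Suc.IH)
    also have "qbinom (N + c) c + (Q ^ (N + b + 1) * qbinom (Suc N + b + d) d +
        (\<Sum>a\<le>d. Q ^ (Suc a * (Suc a + N)) * qbinom b (Suc a) * qbinom (N + c) (d - a))) =
        Q ^ (N + b + 1) * qbinom (Suc N + b + d) d +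
        (\<Sum>a\<le>c. Q ^ (a * (a + N)) * qbinom b a * qbinom (N + c) (c - a))"
      unfolding Suc by (subst sum.atMost_Suc_shift) simp
    also have "(\<Sum>a\<le>c. Q ^ (a * (a + N)) * qbinom b a * qbinom (N + c) (c - a)) = qbinom (N + b + c) c"
      by (rule Suc.IH)
    also have "Q ^ (N + b + 1) * qbinom (Suc N + b + d) d + qbinom (N + b + c) c = qbinom (N + Suc b + c) c"
      using qbinom_Suc_Suc[of "N + Suc b + d" d] by (simp add: Suc)
    finally show ?thesis .
  qed simp
qed

text \<open>For fixed \<open>b\<close>, the sum over \<open>a\<close> is a q-Vandermonde sum up to a
  factor free of \<open>a\<close>, and its value makes the sum over \<open>b\<close> another one.
  The range of \<open>a\<close> is exactly where \<open>b - a\<close> and \<open>P - a - b\<close>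
  are not truncated; it forces \<open>2 * a \<le> P\<close>.\<close>

lemma double_q_vandermonde:
  "(\<Sum>b\<le>P. \<Sum>a\<le>min b (P - b). Q ^ (a * (a + N) + b * (b + N)) /
      (qf a * qf (N + a) * qf (b - a) * qf (P - a - b))) =
   qf (2 * N + 2 * P) / (qf (N + P) * qf P * qf (2 * N + P))"
proof -
  have inner: "(\<Sum>a\<le>min b (P - b). Q ^ (a * (a + N) + b * (b + N)) /
      (qf a * qf (N + a) * qf (b - a) * qf (P - a - b))) =
      Q ^ (b * (b + N)) * qbinom (N + P) b * qbinom (N + P) (P - b) / qf (N + P)"
    if "b \<le> P" for b
  proof -
    have "(\<Sum>a\<le>min b (P - b). Q ^ (a * (a + N) + b * (b + N)) /
        (qf a * qf (N + a) * qf (b - a) * qf (P - a - b))) =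
        (\<Sum>a\<le>min b (P - b). Q ^ (a * (a + N)) * qbinom b a * qbinom (N + (P - b)) (P - b - a) *
          (Q ^ (b * (b + N)) / (qf b * qf (N + P - b))))"
    proof (rule sum.cong)
      fix a assume "a \<in> {..min b (P - b)}"
      then have a: "a \<le> b" "a \<le> P - b"
        by auto
      then have "N + (P - b) - (P - b - a) = N + a" "P - b - a = P - a - b" "N + (P - b) = N + P - b"
        using that by auto
      with a that show "Q ^ (a * (a + N) + b * (b + N)) / (qf a * qf (N + a) * qf (b - a) * qf (P - a - b)) =
          Q ^ (a * (a + N)) * qbinom b a * qbinom (N + (P - b)) (P - b - a) *
          (Q ^ (b * (b + N)) / (qf b * qf (N + P - b)))"
        by (simp add: qbinom_def power_add divide_simps)
    qed simp
    \<comment> \<open>The added terms have \<open>a > b\<close>, so \<open>qbinom b a\<close> is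
      0.\<close>
    also have "\<dots> = (\<Sum>a\<le>P - b. Q ^ (a * (a + N)) * qbinom b a * qbinom (N + (P - b)) (P - b - a) *
          (Q ^ (b * (b + N)) / (qf b * qf (N + P - b))))"
      by (rule sum.mono_neutral_left) auto
    also have "\<dots> = qbinom (N + P) (P - b) * (Q ^ (b * (b + N)) / (qf b * qf (N + P - b)))"
      using q_vandermonde[of N b "P - b"] that by (simp only: flip: sum_distrib_right) simp
    also have "\<dots> = Q ^ (b * (b + N)) * qbinom (N + P) b * qbinom (N + P) (P - b) / qf (N + P)"
      using that by (simp add: qbinom_def[of "N + P" b] divide_simps)
    finally show ?thesis .
  qed
  have "(\<Sum>b\<le>P. \<Sum>a\<le>min b (P - b). Q ^ (a * (a + N) + b * (b + N)) /
      (qf a * qf (N + a) * qf (b - a) * qf (P - a - b))) =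
      (\<Sum>b\<le>P. Q ^ (b * (b + N)) * qbinom (N + P) b * qbinom (N + P) (P - b)) / qf (N + P)"
    unfolding sum_divide_distrib by (intro sum.cong refl inner) simp
  \<comment> \<open>Second convolution, with \<open>N + P\<close> in place of \<open>b\<close> and
    \<open>P\<close> in place of \<open>c\<close>.\<close>
  also have "\<dots> = qbinom (P + (2 * N + P)) P / qf (N + P)"
  proof -
    have "N + (N + P) + P = P + (2 * N + P)"
      by simp
    then show ?thesis
      using q_vandermonde[of N "N + P" P] by (simp only:)
  qed
  also have "\<dots> = qf (2 * N + 2 * P) / (qf (N + P) * qf P * qf (2 * N + P))"
  proof -
    have "P + (2 * N + P) = 2 * N + 2 * P"
      by simp
    then show ?thesis
      using qbinom_add[of P "2 * N + P"] by (simp only:) simp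
  qed
  finally show ?thesis .
qed

section \<open>Polynomials with non-negative coefficients among the fractions\<close>

definition nonneg :: "int poly fract \<Rightarrow> bool" where
  "nonneg x \<longleftrightarrow> (\<exists>p. x = to_fract p \<and> (\<forall>i. coeff p i \<ge> 0))"

lemma nonneg_0 [simp]: "nonneg 0"
  unfolding nonneg_def by (rule exI[of _ 0]) simp

lemma nonneg_Q_power [simp]: "nonneg (Q ^ n)"
  unfolding nonneg_def by (rule exI[of _ "monom 1 n"]) (simp add: Q_power)

lemma nonneg_add: "nonneg x \<Longrightarrow> nonneg y \<Longrightarrow> nonneg (x + y)"
  unfolding nonneg_def by (metis add_nonneg_nonneg coeff_add to_fract_add)

lemma nonneg_mult:
  assumes "nonneg x" "nonneg y"
  shows "nonneg (x * y)"
proof -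
  obtain p r where "x = to_fract p" "y = to_fract r" "\<forall>i. coeff p i \<ge> 0" "\<forall>i. coeff r i \<ge> 0"
    using assms by (auto simp: nonneg_def)
  then have "x * y = to_fract (p * r) \<and> (\<forall>i. coeff (p * r) i \<ge> 0)"
    by (simp add: coeff_mult sum_nonneg)
  then show ?thesis
    unfolding nonneg_def by blast
qed

lemma nonneg_sum: "(\<And>i. i \<in> A \<Longrightarrow> nonneg (f i)) \<Longrightarrow> nonneg (sum f A)"
  by (induction A rule: infinite_finite_induct) (auto intro: nonneg_add)

text \<open>The q-Pascal rule involves only sums and powers of q, so induction gives at once that
  the quotient is a polynomial and that its coefficients are non-negative.\<close>

lemma nonneg_qbinom: "nonneg (qbinom n k)"
proof (induction n arbitrary: k)
  case 0
  show ?case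
    using nonneg_Q_power[of 0] by (cases k) simp_all
next
  case (Suc n)
  show ?case
  proof (cases k)
    case 0
    then show ?thesis
      using nonneg_Q_power[of 0] by simp
  next
    case (Suc l)
    then show ?thesis
      using Suc.IH by (auto simp: qbinom_Suc_Suc intro!: nonneg_add nonneg_mult)
  qed
qed

definition qtrinom :: "nat \<Rightarrow> nat \<Rightarrow> nat \<Rightarrow> int poly fract" where
  "qtrinom i j k = qf (i + j + k) / (qf i * qf j * qf k)"

lemma nonneg_qtrinom: "nonneg (qtrinom i j k)"
proof -
  have "qtrinom i j k = qbinom (i + (j + k)) i * qbinom (j + k) j"
    by (simp add: qtrinom_def qbinom_add add.assoc)
  then show ?thesis
    by (simp add: nonneg_mult nonneg_qbinom)
qed

section \<open>Positivity of the q-super Catalan numbers S(m,n)\<close>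

definition q_super_catalan :: "nat \<Rightarrow> nat \<Rightarrow> int poly fract" where
  "q_super_catalan m n = qf (2 * m) * qf (2 * n) / (qf m * qf n * qf (m + n))"

lemma odd_q_super_catalan_qf:
  "odd_q_super_catalan m n = qf (2 * m + 1) * qf (2 * n) / (qf (m + n + 1) * qf m * qf n)"
  by (simp add: odd_q_super_catalan_def qf_def)

lemma q_super_catalan_commute: "q_super_catalan m n = q_super_catalan n m"
  by (simp add: q_super_catalan_def ac_simps)

text \<open>Multiply the double convolution for \<open>N = n\<close>, \<open>P = p\<close> by [p]!
  [2n]! / [n]!. In each term, inserting [2a]! above and below separates a trinomial of total
  \<open>p\<close> from S(a,n).\<close>

lemma q_super_catalan_expand:
  "q_super_catalan (n + p) n = (\<Sum>b\<le>p. \<Sum>a\<le>min b (p - b).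
     Q ^ (a * (a + n) + b * (b + n)) * qtrinom (2 * a) (b - a) (p - a - b) * q_super_catalan a n)"
proof -
  have "n + p + n = 2 * n + p"
    by simp
  then have "q_super_catalan (n + p) n =
      qf (2 * n + 2 * p) / (qf (n + p) * qf p * qf (2 * n + p)) * (qf p * qf (2 * n) / qf n)"
    unfolding q_super_catalan_def by (simp only: distrib_left) (simp add: divide_simps)
  also have "\<dots> = (\<Sum>b\<le>p. \<Sum>a\<le>min b (p - b). Q ^ (a * (a + n) + b * (b + n)) /
      (qf a * qf (n + a) * qf (b - a) * qf (p - a - b)) * (qf p * qf (2 * n) / qf n))"
    by (simp only: double_q_vandermonde[symmetric] sum_distrib_right)
  also have "\<dots> = (\<Sum>b\<le>p. \<Sum>a\<le>min b (p - b).
     Q ^ (a * (a + n) + b * (b + n)) * qtrinom (2 * a) (b - a) (p - a - b) * q_super_catalan a n)"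
  proof (intro sum.cong refl)
    fix a b assume "b \<in> {..p}" "a \<in> {..min b (p - b)}"
    then have "2 * a + (b - a) + (p - a - b) = p"
      by auto
    then show "Q ^ (a * (a + n) + b * (b + n)) /
        (qf a * qf (n + a) * qf (b - a) * qf (p - a - b)) * (qf p * qf (2 * n) / qf n) =
        Q ^ (a * (a + n) + b * (b + n)) * qtrinom (2 * a) (b - a) (p - a - b) * q_super_catalan a n"
      by (simp add: qtrinom_def q_super_catalan_def add.commute divide_simps)
  qed
  finally show ?thesis .
qed

text \<open>The range of \<open>a\<close> gives \<open>2 * a \<le> p\<close>, so only these values
  of \<open>f\<close> matter. Exponents and trinomial indices are left arbitrary to serve all three
  expansions.\<close>

lemma nonneg_expansion:
  fixes p :: nat
  assumes "\<And>a. 2 * a \<le> p \<Longrightarrow> nonneg (f a)"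
  shows "nonneg (\<Sum>b\<le>p. \<Sum>a\<le>min b (p - b).
    Q ^ (e a b) * qtrinom (i a b) (j a b) (k a b) * f a)"
  by (intro nonneg_sum nonneg_mult nonneg_Q_power nonneg_qtrinom assms) auto

lemma nonneg_q_super_catalan: "nonneg (q_super_catalan m n)"
proof (induction "m + n" arbitrary: m n rule: less_induct)
  case less
  have main: "nonneg (q_super_catalan (n + p) n)"
    if IH: "\<And>a. a + n < (n + p) + n \<Longrightarrow> nonneg (q_super_catalan a n)" for n p
  \<comment> \<open>The expansion of S(0,0) is S(0,0) itself, so this case is done directly.
    Otherwise \<open>2 * a \<le> p\<close> gives \<open>a < n + p\<close>, and the induction
    hypothesis applies.\<close>
  proof (cases "n + p = 0")
    case True
    then show ?thesis
      using nonneg_Q_power[of 0] by (simp add: q_super_catalan_def)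
  next
    case False
    then show ?thesis
      unfolding q_super_catalan_expand by (intro nonneg_expansion IH) auto
  qed
  show ?case
  proof (cases "n \<le> m")
    case True
    then obtain p where "m = n + p"
      using le_Suc_ex by blast
    then show ?thesis
      using main[of n p] less by simp
  next
    case False
    then obtain p where "n = m + p"
      by (metis le_Suc_ex nat_le_linear)
    then show ?thesis
      using main[of m p] less by (simp add: q_super_catalan_commute[of m])
  qed
qed

section \<open>Positivity of the odd q-super Catalan numbers C(m,n)\<close>

lemma odd_q_super_catalan_diagonal: "odd_q_super_catalan m m = q_super_catalan m m"
  by (simp add: odd_q_super_catalan_qf q_super_catalan_def qf_Suc mult_2 divide_simps)

text \<open>Multiply the double convolution for \<open>N = m + 1\<close>, \<open>P = p\<close> by
  [p]! [2m+1]! / [m]!. The shift by 1 in \<open>N\<close> produces the [m+a+1]! in the denominator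
  of C(m,a).\<close>

lemma odd_q_super_catalan_expand_right:
  "odd_q_super_catalan m (m + 1 + p) = (\<Sum>b\<le>p. \<Sum>a\<le>min b (p - b).
     Q ^ (a * (a + (m + 1)) + b * (b + (m + 1))) * qtrinom (2 * a) (b - a) (p - a - b) * odd_q_super_catalan m a)"
proof -
  have "m + (m + 1 + p) + 1 = 2 * (m + 1) + p" "2 * (m + 1 + p) = 2 * (m + 1) + 2 * p"
    by simp_all
  then have "odd_q_super_catalan m (m + 1 + p) =
      qf (2 * (m + 1) + 2 * p) / (qf (m + 1 + p) * qf p * qf (2 * (m + 1) + p)) *
      (qf p * qf (2 * m + 1) / qf m)"
    unfolding odd_q_super_catalan_qf by (simp only:) (simp add: ac_simps divide_simps)
  also have "\<dots> = (\<Sum>b\<le>p. \<Sum>a\<le>min b (p - b). Q ^ (a * (a + (m + 1)) + b * (b + (m + 1))) /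
      (qf a * qf (m + 1 + a) * qf (b - a) * qf (p - a - b)) * (qf p * qf (2 * m + 1) / qf m))"
    by (simp only: double_q_vandermonde[symmetric] sum_distrib_right)
  also have "\<dots> = (\<Sum>b\<le>p. \<Sum>a\<le>min b (p - b).
     Q ^ (a * (a + (m + 1)) + b * (b + (m + 1))) * qtrinom (2 * a) (b - a) (p - a - b) * odd_q_super_catalan m a)"
  proof (intro sum.cong refl)
    fix a b assume "b \<in> {..p}" "a \<in> {..min b (p - b)}"
    then have "2 * a + (b - a) + (p - a - b) = p" "m + a + 1 = m + 1 + a"
      by auto
    then show "Q ^ (a * (a + (m + 1)) + b * (b + (m + 1))) /
        (qf a * qf (m + 1 + a) * qf (b - a) * qf (p - a - b)) * (qf p * qf (2 * m + 1) / qf m) =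
        Q ^ (a * (a + (m + 1)) + b * (b + (m + 1))) * qtrinom (2 * a) (b - a) (p - a - b) * odd_q_super_catalan m a"
      unfolding qtrinom_def odd_q_super_catalan_qf by (simp only:) (simp add: divide_simps)
  qed
  finally show ?thesis .
qed

text \<open>The top factor of the numerator splits as [2n+2p+3] = [2n+p+2] + q^(2n+p+2) [p+1]. The
  first summand cancels against the denominator and leaves S(n+1+p,n); the second is treated by the
  double convolution.\<close>

lemma odd_q_super_catalan_expand_left:
  "odd_q_super_catalan (n + 1 + p) n = q_super_catalan (n + 1 + p) n + Q ^ (2 * (n + 1) + p) *
     (\<Sum>b\<le>p. \<Sum>a\<le>min b (p - b). Q ^ (a * (a + (n + 1)) + b * (b + (n + 1))) *
        qtrinom (2 * a + 1) (b - a) (p - a - b) * odd_q_super_catalan a n)"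
proof -
  \<comment> \<open>The value of the double convolution for \<open>N = n + 1\<close>,
    \<open>P = p\<close>. The leftover factor [p+1] turns the multiplier [p]! into [p+1]!.\<close>
  define c where "c = qf (2 * (n + 1) + 2 * p) / (qf (n + 1 + p) * qf p * qf (2 * (n + 1) + p))"
  have "qi (Suc (2 * (n + 1) + 2 * p)) = qi (2 * (n + 1) + p) + Q ^ (2 * (n + 1) + p) * qi (Suc p)"
    using qi_add[of "2 * (n + 1) + p" "Suc p"] by (simp add: mult_2 add.assoc)
  moreover have "qf (2 * (n + 1) + p) = qf (2 * n + 1 + p) * qi (2 * (n + 1) + p)"
    using qf_Suc[of "2 * n + 1 + p"] by simp
  moreover have "qf (Suc (2 * (n + 1) + 2 * p)) = qf (2 * (n + 1) + 2 * p) * qi (Suc (2 * (n + 1) + 2 * p))"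
      "qf (Suc p) = qf p * qi (Suc p)"
    by (rule qf_Suc)+
  moreover have "qi (2 * (n + 1) + p) \<noteq> 0"
    using qi_Suc_nonzero[of "2 * n + 1 + p"] by simp
  moreover have "n + 1 + p + n + 1 = 2 * (n + 1) + p" "n + 1 + p + n = 2 * n + 1 + p"
      "2 * (n + 1 + p) + 1 = Suc (2 * (n + 1) + 2 * p)" "2 * (n + 1 + p) = 2 * (n + 1) + 2 * p"
    by simp_all
  ultimately have "odd_q_super_catalan (n + 1 + p) n = q_super_catalan (n + 1 + p) n +
      Q ^ (2 * (n + 1) + p) * (c * (qf (Suc p) * qf (2 * n) / qf n))"
    unfolding odd_q_super_catalan_qf q_super_catalan_def c_def
    by (simp only:) (simp add: field_simps del: mult_Suc_right)
  also have "c * (qf (Suc p) * qf (2 * n) / qf n) =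
     (\<Sum>b\<le>p. \<Sum>a\<le>min b (p - b). Q ^ (a * (a + (n + 1)) + b * (b + (n + 1))) /
      (qf a * qf (n + 1 + a) * qf (b - a) * qf (p - a - b)) * (qf (Suc p) * qf (2 * n) / qf n))"
    by (simp only: c_def double_q_vandermonde[symmetric] sum_distrib_right)
  also have "\<dots> = (\<Sum>b\<le>p. \<Sum>a\<le>min b (p - b).
     Q ^ (a * (a + (n + 1)) + b * (b + (n + 1))) * qtrinom (2 * a + 1) (b - a) (p - a - b) * odd_q_super_catalan a n)"
  proof (intro sum.cong refl)
    fix a b assume "b \<in> {..p}" "a \<in> {..min b (p - b)}"
    \<comment> \<open>The trinomial now has total \<open>p + 1\<close>, which leaves room for the
      index \<open>2 * a + 1\<close> and thus for the [2a+1]! of C(a,n).\<close>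
    then have "2 * a + 1 + (b - a) + (p - a - b) = Suc p" "a + n + 1 = n + 1 + a"
      by auto
    then show "Q ^ (a * (a + (n + 1)) + b * (b + (n + 1))) /
        (qf a * qf (n + 1 + a) * qf (b - a) * qf (p - a - b)) * (qf (Suc p) * qf (2 * n) / qf n) =
        Q ^ (a * (a + (n + 1)) + b * (b + (n + 1))) * qtrinom (2 * a + 1) (b - a) (p - a - b) * odd_q_super_catalan a n"
      unfolding qtrinom_def odd_q_super_catalan_qf by (simp only:) (simp add: divide_simps)
  qed
  finally show ?thesis .
qed

text \<open>Off the diagonal, the larger argument exceeds \<open>p\<close>, whereas the argument
  \<open>a\<close> replacing it satisfies \<open>2 * a \<le> p\<close>. So the sum of the arguments
  drops even for \<open>p = 0\<close>, and the diagonal needs no induction hypothesis.\<close>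

lemma nonneg_odd_q_super_catalan: "nonneg (odd_q_super_catalan m n)"
proof (induction "m + n" arbitrary: m n rule: less_induct)
  case less
  consider "m = n" | p where "n = m + 1 + p" | p where "m = n + 1 + p"
    by (metis Suc_eq_plus1 add.assoc add_Suc_right less_iff_Suc_add linorder_neqE_nat plus_1_eq_Suc)
  then show ?case
  proof cases
    case 1
    then show ?thesis
      by (simp add: odd_q_super_catalan_diagonal nonneg_q_super_catalan)
  next
    case (2 p)
    then have "nonneg (odd_q_super_catalan m a)" if "2 * a \<le> p" for a
      using that by (intro less) simp
    then show ?thesis
      unfolding 2 odd_q_super_catalan_expand_right by (rule nonneg_expansion)
  next
    case (3 p)
    then have "nonneg (odd_q_super_catalan a n)" if "2 * a \<le> p" for a
      using that by (intro less) simp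
    then show ?thesis
      unfolding 3 odd_q_super_catalan_expand_left
      by (intro nonneg_add nonneg_mult nonneg_q_super_catalan nonneg_Q_power nonneg_expansion)
  qed
qed

theorem theorem1p1:
  fixes m n :: nat
  shows "\<exists>p :: int poly. odd_q_super_catalan m n = to_fract p \<and> (\<forall>i. coeff p i \<ge> 0)"
  using nonneg_odd_q_super_catalan[of m n] by (simp only: nonneg_def)

end
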